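(* Let $X$ be a (real) Hilbert space, let $r>0$, let $B_r^X(0)\subset X$ be the closed ball of radius $r$ centered at $0$, and let $f$ be a (single-valued or multi-valued) mapping acting in $X$, defined on $B_r^X(0)$, such that $f(B_r^X(0))\subseteq B_r^X(0)$. Put $f_1(x)=x-f(x)$ for $x\in B_r^X(0)$. If the image $f_1(B_r^X(0))\subset X$ is an open (or closed) convex set, then there exists $x_0\in B_r^X(0)$ such that $f(x_0)=x_0$ (respectively $x_0\in f(x_0)$ if $f$ is multi-valued).
   Context: No continuity of $f$ is assumed. A multi-valued mapping assigns to each point $x$ of its domain a nonempty subset $f(x)$; $f(G)=\bigcup_{x\in G}f(x)$, and $x-f(x)=\{x-y: y\in f(x)\}$. *)

theory Defs
  imports "HOL-Analysis.Analysis"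
begin

text \<open>
  A multi-valued mapping of \<open>'a\<close> into \<open>'b\<close> with domain \<open>D\<close> is a function \<open>'a \<Rightarrow> 'b set\<close> whose
  values at the points of \<open>D\<close> are nonempty; its values outside \<open>D\<close> are irrelevant.
\<close>

definition multimap_on :: "'a set \<Rightarrow> ('a \<Rightarrow> 'b set) \<Rightarrow> bool"
  where "multimap_on D F \<longleftrightarrow> (\<forall>x\<in>D. F x \<noteq> {})"

definition multimap_image :: "('a \<Rightarrow> 'b set) \<Rightarrow> 'a set \<Rightarrow> 'b set"
  where "multimap_image F G = (\<Union>x\<in>G. F x)"

definition id_minus_multimap :: "('a \<Rightarrow> 'a set) \<Rightarrow> 'a::ab_group_add \<Rightarrow> 'a set"
  where "id_minus_multimap F x = {x - y |y. y \<in> F x}"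

end

theory Submission
  imports Defs
begin

text \<open>
  If \<open>0\<close> is not in the convex set \<open>C\<close> of all differences \<open>x - y\<close> with \<open>y \<in> F x\<close>, some vector
  \<open>e\<close> has positive inner product with all of \<open>C\<close>. But at the point \<open>x\<close> of the ball where
  \<open>\<langle>e, x\<rangle>\<close> is minimal, \<open>\<langle>e, x - y\<rangle> \<le> 0\<close> for every \<open>y\<close> in the ball.
  For closed \<open>C\<close> the vector \<open>e\<close> is the point of \<open>C\<close> nearest to \<open>0\<close>. For open \<open>C\<close> one
  separates a point \<open>-c\<close>, \<open>c \<in> C\<close>, from the closed cone generated by \<open>C\<close>.
\<close>

text \<open>Midpoints stay in the convex set \<open>S\<close>, so the parallelogram identity makes
  every norm-minimizing sequence Cauchy; completeness supplies its limit and closedness keeps the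
  limit in \<open>S\<close>.\<close>

lemma convex_closed_min_norm:
  fixes S :: "'a::{real_inner, complete_space} set"
  assumes "closed S" "convex S" "S \<noteq> {}"
  obtains p where "p \<in> S" "\<And>z. z \<in> S \<Longrightarrow> norm p \<le> norm z"
proof -
  define d where "d = (INF z\<in>S. (norm z)\<^sup>2)"
  have bdd: "bdd_below ((\<lambda>z. (norm z)\<^sup>2) ` S)"
    by (rule bdd_belowI[of _ 0]) auto
  have lower: "d \<le> (norm z)\<^sup>2" if "z \<in> S" for z
    unfolding d_def by (rule cINF_lower[OF bdd that])
  have near: "\<exists>z\<in>S. (norm z)\<^sup>2 < d + e" if "e > 0" for e
    using cINF_less_iff[OF \<open>S \<noteq> {}\<close> bdd, of "d + e"] that unfolding d_def by simp
  have "\<exists>z. z \<in> S \<and> (norm z)\<^sup>2 < d + 1 / real (Suc n)" for n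
    using near[of "1 / real (Suc n)"] by auto
  then obtain u where u: "\<And>n. u n \<in> S" "\<And>n. (norm (u n))\<^sup>2 < d + 1 / real (Suc n)"
    by metis
  \<comment> \<open>The midpoint lies in \<open>S\<close>, so the norm of \<open>a + b\<close>
    squared is at least \<open>4 * d\<close>. The parallelogram identity then leaves at most
    \<open>4 * e\<close> for the squared distance.\<close>
  have gap: "(dist a b)\<^sup>2 \<le> 4 * e" if "a \<in> S" "b \<in> S" "(norm a)\<^sup>2 < d + e" "(norm b)\<^sup>2 < d + e" for a b e
  proof -
    have "(1/2) *\<^sub>R a + (1/2) *\<^sub>R b \<in> S"
      using convexD[OF \<open>convex S\<close> that(1,2), of "1/2" "1/2"] by simp
    then have "d \<le> (norm ((1/2) *\<^sub>R (a + b)))\<^sup>2"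
      using lower by (simp add: scaleR_add_right)
    then have "4 * d \<le> (norm (a + b))\<^sup>2"
      by (simp add: power_divide)
    moreover have "(dist a b)\<^sup>2 + (norm (a + b))\<^sup>2 = 2 * (norm a)\<^sup>2 + 2 * (norm b)\<^sup>2"
      by (simp add: dist_norm power2_norm_eq_inner inner_add inner_diff inner_commute)
    ultimately show ?thesis
      using that by linarith
  qed
  have "Cauchy u"
    unfolding Cauchy_def
  proof (intro allI impI)
    fix e :: real assume "e > 0"
    \<comment> \<open>The bound \<open>gap\<close> loses a factor 4 and concerns squares, hence the
      tolerance \<open>e\<^sup>2 / 4\<close>.\<close>
    then obtain N where N: "1 / real (Suc N) < e\<^sup>2 / 4"
      using nat_approx_posE[of "e\<^sup>2 / 4"] by auto
    have "dist (u m) (u n) < e" if "m \<ge> N" "n \<ge> N" for m n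
    proof -
      have close: "(norm (u k))\<^sup>2 < d + 1 / real (Suc N)" if "k \<ge> N" for k
      proof -
        have "1 / real (Suc k) \<le> 1 / real (Suc N)"
          using that by (simp add: field_simps)
        then show ?thesis
          using u(2)[of k] by linarith
      qed
      have "(dist (u m) (u n))\<^sup>2 \<le> 4 * (1 / real (Suc N))"
        by (rule gap[OF u(1) u(1) close[OF that(1)] close[OF that(2)]])
      also have "\<dots> < e\<^sup>2"
        using N by simp
      finally show ?thesis
        using \<open>e > 0\<close> by (simp add: power2_less_imp_less)
    qed
    then show "\<exists>N. \<forall>m\<ge>N. \<forall>n\<ge>N. dist (u m) (u n) < e"
      by blast
  qed
  then obtain p where p: "u \<longlonglongrightarrow> p"
    using Cauchy_convergent convergent_def by blast
  have "p \<in> S"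
    using closed_sequentially[OF \<open>closed S\<close> _ p] u(1) by blast
  moreover have "norm p \<le> norm z" if "z \<in> S" for z
  proof -
    have "(\<lambda>n. d + 1 / real (Suc n)) \<longlonglongrightarrow> d + 0"
      by (intro tendsto_add tendsto_const LIMSEQ_Suc lim_1_over_n)
    moreover have "(\<lambda>n. (norm (u n))\<^sup>2) \<longlonglongrightarrow> (norm p)\<^sup>2"
      by (intro tendsto_intros p)
    ultimately have "(norm p)\<^sup>2 \<le> d"
      using u(2) by (intro LIMSEQ_le) (auto intro: less_imp_le)
    then have "(norm p)\<^sup>2 \<le> (norm z)\<^sup>2"
      using lower[OF that] by linarith
    then show ?thesis
      by (rule power2_le_imp_le) simp
  qed
  ultimately show ?thesis
    using that by blast
qed

lemma separate_closed_convex_0: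
  fixes S :: "'a::{real_inner, complete_space} set"
  assumes "closed S" "convex S" "0 \<notin> S"
  shows "\<exists>e. \<forall>z\<in>S. 0 < e \<bullet> z"
proof (cases "S = {}")
  case False
  then obtain p where p: "p \<in> S" "\<And>z. z \<in> S \<Longrightarrow> norm p \<le> norm z"
    using convex_closed_min_norm assms by blast
  have "0 < p \<bullet> z" if "z \<in> S" for z
  proof -
    \<comment> \<open>Variational inequality at the nearest point \<open>p\<close>: the angle
      between \<open>0 - p\<close> and \<open>z - p\<close> is not acute.\<close>
    have "(0 - p) \<bullet> (z - p) \<le> 0"
      using p by (intro any_closest_point_dot[OF \<open>convex S\<close> \<open>closed S\<close>]) (auto simp: that)
    then have "p \<bullet> p \<le> p \<bullet> z"
      by (simp add: inner_diff_right)
    moreover have "0 < p \<bullet> p"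
      using p(1) \<open>0 \<notin> S\<close> by auto
    ultimately show ?thesis
      by linarith
  qed
  then show ?thesis
    by blast
qed auto

text \<open>Here \<open>0\<close> may lie in the closure of \<open>S\<close>, so a nearest point to
  \<open>0\<close> may give only the zero vector. Separating from the cone yields a nonzero
  \<open>e\<close> that is nonnegative on \<open>S\<close>, and openness makes the inequality
  strict.\<close>

lemma separate_open_convex_0:
  fixes S :: "'a::{real_inner, complete_space} set"
  assumes "open S" "convex S" "0 \<notin> S"
  shows "\<exists>e. \<forall>z\<in>S. 0 < e \<bullet> z"
proof (cases "S = {}")
  case False
  then obtain c where "c \<in> S"
    by blast
  define K where "K = closure (cone hull S)"
  have hull: "cone hull S = {t *\<^sub>R x |t x. 0 \<le> t \<and> x \<in> S}"
    by (rule cone_hull_expl)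
  \<comment> \<open>A point \<open>w\<close> of the cone close to \<open>- c\<close> would have
    \<open>- w\<close> close to \<open>c\<close>, hence in \<open>S\<close>.\<close>
  have "- c \<notin> K"
  proof
    assume "- c \<in> K"
    obtain \<delta> where "\<delta> > 0" and \<delta>: "ball c \<delta> \<subseteq> S"
      using \<open>open S\<close> \<open>c \<in> S\<close> open_contains_ball by blast
    obtain w where "w \<in> cone hull S" and w: "dist w (- c) < \<delta>"
      using \<open>- c \<in> K\<close> \<open>\<delta> > 0\<close> unfolding K_def closure_approachable by blast
    then obtain t x where tx: "t \<ge> 0" "x \<in> S" "w = t *\<^sub>R x"
      unfolding hull by blast
    have "dist c (- w) < \<delta>"
      using w by (simp add: dist_norm add.commute)
    then have "- w \<in> S"
      using \<delta> by auto
    \<comment> \<open>As \<open>w = t *\<^sub>R x\<close>, these weights make the combination equal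
      to \<open>0\<close>.\<close>
    then have "(t / (1 + t)) *\<^sub>R x + (1 / (1 + t)) *\<^sub>R (- w) \<in> S"
      using tx by (intro convexD[OF \<open>convex S\<close>]) (auto simp: add_divide_distrib[symmetric])
    then show False
      using tx \<open>0 \<notin> S\<close> by simp
  qed
  \<comment> \<open>Translation by \<open>c\<close> moves the excluded point \<open>- c\<close> to
    \<open>0\<close>, where the closed case applies.\<close>
  then have "0 \<notin> (+) c ` K"
    by (auto simp: add_eq_0_iff)
  moreover have "closed ((+) c ` K)" "convex ((+) c ` K)"
    unfolding K_def
    by (simp_all add: closed_translation convex_translation convex_cone_hull \<open>convex S\<close>)
  ultimately obtain e where "\<forall>z\<in>(+) c ` K. 0 < e \<bullet> z"
    using separate_closed_convex_0 by blast
  moreover have "t *\<^sub>R z \<in> K" if "t \<ge> 0" "z \<in> S" for t z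
    unfolding K_def hull using that by (intro subsetD[OF closure_subset]) blast
  ultimately have e: "0 < e \<bullet> (c + t *\<^sub>R z)" if "t \<ge> 0" "z \<in> S" for t z
    using that by blast
  have "0 < e \<bullet> c"
    using e[of 0 c] \<open>c \<in> S\<close> by simp
  have nonneg: "0 \<le> e \<bullet> z" if "z \<in> S" for z
  proof (rule ccontr)
    assume neg: "\<not> 0 \<le> e \<bullet> z"
    \<comment> \<open>The multiple of \<open>z\<close> is chosen so that this inner product is
      exactly 0.\<close>
    have "0 < e \<bullet> (c + ((e \<bullet> c) / - (e \<bullet> z)) *\<^sub>R z)"
      using neg \<open>0 < e \<bullet> c\<close> that by (intro e) (auto simp: divide_nonneg_neg)
    then show False
      using neg by (simp add: inner_diff_right)
  qed
  \<comment> \<open>Openness allows a small step from \<open>z\<close> along \<open>- c\<close>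
    inside \<open>S\<close>; nonnegativity there gives \<open>e \<bullet> z\<close> at least
    \<open>t * (e \<bullet> c)\<close>, which is positive.\<close>
  have "0 < e \<bullet> z" if "z \<in> S" for z
  proof -
    have "((\<lambda>t. z - t *\<^sub>R c) \<longlongrightarrow> z - 0 *\<^sub>R c) (at_right 0)"
      by (intro tendsto_intros)
    then have "\<forall>\<^sub>F t in at_right 0. z - t *\<^sub>R c \<in> S"
      using topological_tendstoD[OF _ \<open>open S\<close>] that by fastforce
    then have "\<forall>\<^sub>F t in at_right (0::real). z - t *\<^sub>R c \<in> S \<and> 0 < t"
      by (intro eventually_conj eventually_at_right_less)
    then obtain t :: real where t: "z - t *\<^sub>R c \<in> S" "t > 0"
      using eventually_happens'[OF trivial_limit_at_right_real] by blast
    have "t * (e \<bullet> c) \<le> e \<bullet> z"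
      using nonneg[OF t(1)] by (simp add: inner_diff_right)
    then show ?thesis
      using mult_pos_pos[OF \<open>t > 0\<close> \<open>0 < e \<bullet> c\<close>] by linarith
  qed
  then show ?thesis
    by blast
qed auto

text \<open>Common core of both claims. Naming the image \<open>C\<close> through an equation lets
  the single-valued image be substituted directly.\<close>

lemma multimap_fixed_point:
  fixes F :: "'a::{real_inner, complete_space} \<Rightarrow> 'a set"
  assumes "r \<ge> 0" and "multimap_on (cball 0 r) F"
    and "multimap_image F (cball 0 r) \<subseteq> cball 0 r"
    and C: "C = multimap_image (id_minus_multimap F) (cball 0 r)"
    and "open C \<or> closed C" and "convex C"
  shows "\<exists>x\<in>cball 0 r. x \<in> F x"
proof (rule ccontr)
  assume "\<not> ?thesis"
  then have "0 \<notin> C"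
    by (auto simp: C multimap_image_def id_minus_multimap_def)
  then obtain e where e: "\<And>z. z \<in> C \<Longrightarrow> 0 < e \<bullet> z"
    using separate_open_convex_0[of C] separate_closed_convex_0[of C] assms(5,6) by auto
  \<comment> \<open>The minimizer of the inner product with \<open>e\<close> on the ball. Since
    \<open>sgn 0 = 0\<close>, the formula also covers \<open>e = 0\<close>, giving the
    centre.\<close>
  define x where "x = - r *\<^sub>R sgn e"
  have x: "x \<in> cball 0 r"
    using \<open>r \<ge> 0\<close> by (simp add: x_def norm_sgn)
  then obtain y where y: "y \<in> F x"
    using assms(2) unfolding multimap_on_def by blast
  then have "y \<in> cball 0 r"
    using assms(3) x unfolding multimap_image_def by blast
  then have "norm y \<le> r"
    by simp
  have "0 < e \<bullet> (x - y)"
  proof (rule e)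
    show "x - y \<in> C"
      using x y unfolding C multimap_image_def id_minus_multimap_def by blast
  qed
  moreover have "e \<bullet> x = - (norm e * r)"
    by (cases "e = 0") (simp_all add: x_def sgn_div_norm dot_square_norm power2_eq_square)
  moreover have "- (e \<bullet> y) \<le> norm e * norm y"
    using norm_cauchy_schwarz[of e "- y"] by simp
  moreover have "norm e * norm y \<le> norm e * r"
    using \<open>norm y \<le> r\<close> by (simp add: mult_left_mono)
  ultimately show False
    by (simp add: inner_diff_right)
qed

theorem theorem1:
  fixes r :: real
  assumes "r > 0"
  shows "(\<forall>f :: 'a::{real_inner, complete_space} \<Rightarrow> 'a.
            f ` cball 0 r \<subseteq> cball 0 r \<longrightarrow>
            (let f\<^sub>1 = (\<lambda>x. x - f x) in
              (open (f\<^sub>1 ` cball 0 r) \<or> closed (f\<^sub>1 ` cball 0 r)) \<and> convex (f\<^sub>1 ` cball 0 r)) \<longrightarrow>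
            (\<exists>x\<^sub>0\<in>cball 0 r. f x\<^sub>0 = x\<^sub>0)) \<and>
         (\<forall>F :: 'a \<Rightarrow> 'a set.
            multimap_on (cball 0 r) F \<longrightarrow>
            multimap_image F (cball 0 r) \<subseteq> cball 0 r \<longrightarrow>
            (let F\<^sub>1 = id_minus_multimap F in
              (open (multimap_image F\<^sub>1 (cball 0 r)) \<or> closed (multimap_image F\<^sub>1 (cball 0 r))) \<and>
              convex (multimap_image F\<^sub>1 (cball 0 r))) \<longrightarrow>
            (\<exists>x\<^sub>0\<in>cball 0 r. x\<^sub>0 \<in> F x\<^sub>0))"
proof (intro conjI allI impI)
  fix f :: "'a \<Rightarrow> 'a"
  assume f: "f ` cball 0 r \<subseteq> cball 0 r"
    and f1: "let f\<^sub>1 = (\<lambda>x. x - f x) in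
      (open (f\<^sub>1 ` cball 0 r) \<or> closed (f\<^sub>1 ` cball 0 r)) \<and> convex (f\<^sub>1 ` cball 0 r)"
  \<comment> \<open>A single-valued map is treated as the multi-valued one with singleton
    values.\<close>
  have "\<exists>x\<in>cball 0 r. x \<in> {f x}"
  proof (rule multimap_fixed_point)
    show "(\<lambda>x. x - f x) ` cball 0 r = multimap_image (id_minus_multimap (\<lambda>x. {f x})) (cball 0 r)"
      by (auto simp: multimap_image_def id_minus_multimap_def)
  qed (use assms f f1 in \<open>auto simp: multimap_on_def multimap_image_def Let_def\<close>)
  then show "\<exists>x\<^sub>0\<in>cball 0 r. f x\<^sub>0 = x\<^sub>0"
    by (metis singletonD)
next
  fix F :: "'a \<Rightarrow> 'a set"
  assume "multimap_on (cball 0 r) F" "multimap_image F (cball 0 r) \<subseteq> cball 0 r"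
    and "let F\<^sub>1 = id_minus_multimap F in
      (open (multimap_image F\<^sub>1 (cball 0 r)) \<or> closed (multimap_image F\<^sub>1 (cball 0 r))) \<and>
      convex (multimap_image F\<^sub>1 (cball 0 r))"
  then show "\<exists>x\<^sub>0\<in>cball 0 r. x\<^sub>0 \<in> F x\<^sub>0"
    using multimap_fixed_point[of r F, OF _ _ _ refl] assms by (simp add: Let_def)
qed

end
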